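(* Let $\rho\in\mathbb{C}$, let $x\in(0,\infty)$, and let $a,b,c,d>0$ except for possibly a pair of complex conjugates with positive real parts among $a,b,c$ and among $a,b,d$. Then $$ e^\rho\ {}_2F_2\!\left(\begin{matrix}a+ix,\ a-ix\\ a+b,\ a+c\end{matrix};-\rho\right)= \sum_{k=0}^\infty \frac{\rho^k\,S_k(x^2;a,b,d)}{(a+b)_k\,(a+c)_k\,k!}\ {}_1F_1\!\left(\begin{matrix}c-d\\ k+a+c\end{matrix};\rho\right). $$
   Context: The Pochhammer symbol is $(z)_n=\prod_{i=1}^n(z+i-1)$ (so $(z)_0=1$). The generalized hypergeometric function is ${}_pF_q(a_1,\dots,a_p;b_1,\dots,b_q;z)=\sum_{n\ge0}\frac{(a_1)_n\cdots(a_p)_n}{(b_1)_n\cdots(b_q)_n}\frac{z^n}{n!}$. The continuous dual Hahn polynomials are $$S_n(x^2;a,b,c)=(a+b)_n(a+c)_n\ {}_3F_2\!\left(\begin{matrix}-n,\ a+ix,\ a-ix\\ a+b,\ a+c\end{matrix};1\right).$$ The parameter hypothesis means: all parameters have positive real part, and in each of the lists $a,b,c$ and $a,b,d$ the non-real entries (if any) form a complex conjugate pair. *)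

theory Defs
  imports "HOL-Analysis.Analysis"
begin

text \<open>The value of \<open>\<^sub>pF\<^sub>q\<close> at \<open>z\<close>, with the numerator and
  denominator parameters given as lists. As a \<^const>\<open>suminf\<close>, it is meaningful only where
  the series converges and no denominator parameter is a nonpositive integer.\<close>

definition hypergeom :: "complex list \<Rightarrow> complex list \<Rightarrow> complex \<Rightarrow> complex" where
  "hypergeom as bs z =
     (\<Sum>n. (\<Prod>a\<leftarrow>as. pochhammer a n) / (\<Prod>b\<leftarrow>bs. pochhammer b n) * (z ^ n / fact n))"

lemma hypergeom_conv_fps_hypergeo: "hypergeom as bs z = eval_fps (fps_hypergeo as bs 1) z"
proof -
  have foldl_mult: "foldl (\<lambda>r a. r * pochhammer a n) u xs = u * (\<Prod>a\<leftarrow>xs. pochhammer a n)"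
    for u :: complex and xs n
    by (induction xs arbitrary: u) (simp_all add: mult.assoc)
  show ?thesis
    unfolding hypergeom_def eval_fps_def fps_hypergeo_def
    by (simp add: foldl_mult)
qed

text \<open>The continuous dual Hahn polynomial \<open>S\<^sub>n(y; a, b, c)\<close>. Its argument is
  \<open>y = x\<^sup>2\<close>; since the defining expression is even in \<open>x\<close>, any square root of \<open>y\<close>
  can serve as \<open>x\<close>, as the lemma below confirms.\<close>

definition cont_dual_hahn ::
  "nat \<Rightarrow> complex \<Rightarrow> complex \<Rightarrow> complex \<Rightarrow> complex \<Rightarrow> complex" where
  "cont_dual_hahn n y a b c =
     pochhammer (a + b) n * pochhammer (a + c) n *
     hypergeom [- of_nat n, a + \<i> * csqrt y, a - \<i> * csqrt y] [a + b, a + c] 1"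

lemma cont_dual_hahn_square:
  "cont_dual_hahn n (x\<^sup>2) a b c =
     pochhammer (a + b) n * pochhammer (a + c) n *
     hypergeom [- of_nat n, a + \<i> * x, a - \<i> * x] [a + b, a + c] 1"
proof -
  have "csqrt (x\<^sup>2) = x \<or> csqrt (x\<^sup>2) = - x"
    by (metis power2_csqrt power2_eq_iff)
  then show ?thesis
    by (auto simp: cont_dual_hahn_def hypergeom_def mult_ac)
qed

definition admissible_params :: "complex list \<Rightarrow> bool" where
  "admissible_params zs \<longleftrightarrow>
     (\<forall>z\<in>set zs. Re z > 0) \<and>
     (filter (\<lambda>z. z \<notin> \<real>) zs = [] \<or> (\<exists>w. filter (\<lambda>z. z \<notin> \<real>) zs = [w, cnj w]))"

end

theory Submission
  imports Defs
begin

text \<open>Expanding \<open>S\<^sub>k\<close> and \<open>\<^sub>1F\<^sub>1\<close> turns the right-hand side into a triple series over \<open>(j, m, n)\<close>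
  with \<open>k = j + m\<close>. Its terms are dominated by \<open>A\<^sup>j B\<^sup>m C\<^sup>n / (j! m! n!)\<close>, because
  \<open>(z)\<^sub>n\<close> is at most geometric times \<open>n!\<close>, and at least so when \<open>Re z > 0\<close>, and
  \<open>(j + m)! n! \<le> (j + m + n)!\<close>; so it may be rearranged. For fixed \<open>j\<close> and \<open>m + n = N\<close> the
  Chu--Vandermonde identity collapses the inner sum to \<open>\<rho>\<^sup>N / N!\<close> times the \<open>j\<close>-th term of
  \<open>\<^sub>2F\<^sub>2\<close>, and summing over \<open>N\<close> yields \<open>e\<^sup>\<rho>\<close>.\<close>

section \<open>Growth bounds for Pochhammer symbols\<close>

lemma norm_pochhammer_le_fact:
  fixes z :: "'a :: real_normed_field"
  shows "\<exists>K\<ge>0. \<forall>n. norm (pochhammer z n) \<le> K ^ n * fact n"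
proof (intro exI conjI allI)
  \<comment> \<open>This constant bounds each factor:
    \<open>norm (z + of_nat n) \<le> ?K * (n + 1)\<close>, and the factors \<open>n + 1\<close>
    multiply to the factorial.\<close>
  let ?K = "max 1 (norm z)"
  show "?K \<ge> 0" by simp
  show "norm (pochhammer z n) \<le> ?K ^ n * fact n" for n
  proof (induction n)
    case (Suc n)
    have "norm (z + of_nat n) \<le> norm z + real n"
      using norm_triangle_ineq[of z "of_nat n"] by simp
    also have "\<dots> \<le> ?K * 1 + ?K * real n"
      using mult_right_mono[of 1 ?K "real n"] by simp
    finally have "norm (z + of_nat n) \<le> ?K * real (Suc n)"
      by (simp only: of_nat_Suc distrib_left)
    then have "norm (z + of_nat n) * norm (pochhammer z n) \<le> (?K * real (Suc n)) * (?K ^ n * fact n)"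
      by (intro mult_mono Suc.IH) auto
    then show ?case
      by (simp add: pochhammer_rec' norm_mult mult_ac)
  qed simp
qed

text \<open>A positive real part keeps every factor away from zero:
  \<open>norm (z + of_nat n)\<close> is at least \<open>Re z + n\<close>, hence at least
  \<open>min 1 (Re z) * (n + 1)\<close>. Inverting and multiplying gives the bound.\<close>

lemma norm_inverse_pochhammer_le_fact:
  fixes z :: complex
  assumes "Re z > 0"
  shows "\<exists>L\<ge>0. \<forall>n. norm (inverse (pochhammer z n)) \<le> L ^ n / fact n"
proof (intro exI conjI allI)
  let ?L = "inverse (min 1 (Re z))"
  have pos: "min 1 (Re z) > 0" using assms by simp
  then show "?L \<ge> 0" by simp
  show "norm (inverse (pochhammer z n)) \<le> ?L ^ n / fact n" for n
  proof (induction n)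
    case (Suc n)
    have "min 1 (Re z) * real (Suc n) = min 1 (Re z) * 1 + min 1 (Re z) * real n"
      by (simp only: of_nat_Suc distrib_left add.commute)
    also have "\<dots> \<le> Re z + real n"
      using mult_right_mono[of "min 1 (Re z)" 1 "real n"] by simp
    also have "\<dots> \<le> norm (z + of_nat n)"
      using complex_Re_le_cmod[of "z + of_nat n"] by simp
    finally have "min 1 (Re z) * real (Suc n) \<le> norm (z + of_nat n)" .
    then have "inverse (norm (z + of_nat n)) \<le> inverse (min 1 (Re z) * real (Suc n))"
      using pos by (intro le_imp_inverse_le) auto
    then have "inverse (norm (z + of_nat n)) * norm (inverse (pochhammer z n))
        \<le> inverse (min 1 (Re z) * real (Suc n)) * (?L ^ n / fact n)"
      using pos by (intro mult_mono Suc.IH) auto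
    then show ?case
      by (simp add: pochhammer_rec' norm_mult norm_inverse divide_inverse mult_ac)
  qed simp
qed

lemma pochhammer_Re_pos_nonzero:
  fixes z :: complex
  assumes "Re z > 0"
  shows "pochhammer z n \<noteq> 0"
proof
  assume "pochhammer z n = 0"
  then obtain k where "z = - of_nat k"
    by (auto simp: pochhammer_eq_0_iff)
  then show False using assms by simp
qed

lemma pochhammer_neg_of_nat:
  assumes "j \<le> k"
  shows "pochhammer (- of_nat k) j = ((- 1) ^ j * fact k / fact (k - j) :: 'a :: field_char_0)"
proof -
  have "(fact k :: 'a) = fact (k - j) * pochhammer (1 + of_nat (k - j)) j"
    using pochhammer_product'[of "1 :: 'a" "k - j" j] assms by (simp add: pochhammer_fact)
  then show ?thesis
    using assms by (simp add: pochhammer_minus of_nat_diff algebra_simps)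
qed

text \<open>An unconditional sum may be grouped along the finite antidiagonals
  \<open>j + m = k\<close>. This serves twice: to group \<open>(m, n)\<close> by
  \<open>N = m + n\<close>, and \<open>(j, m)\<close> by \<open>k = j + m\<close>.\<close>

lemma has_sum_antidiagonals:
  fixes f :: "nat \<times> nat \<Rightarrow> 'a :: real_normed_vector"
  assumes "(f has_sum S) UNIV"
  shows "((\<lambda>k. \<Sum>j\<le>k. f (j, k - j)) has_sum S) UNIV"
proof (rule has_sum_SigmaD[where A = UNIV and B = "\<lambda>k. {..k}" and f = "\<lambda>(k, j). f (j, k - j)"])
  have "bij_betw (\<lambda>(k, j). (j, k - j)) (SIGMA k:UNIV. {..k}) (UNIV :: (nat \<times> nat) set)"
    by (rule bij_betwI[of _ _ _ "\<lambda>(j, m). (j + m, j)"]) auto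
  from has_sum_reindex_bij_betw[OF this, of f S] assms
  show "((\<lambda>(k, j). f (j, k - j)) has_sum S) (SIGMA k:UNIV. {..k})"
    by (simp add: case_prod_unfold)
qed (simp add: has_sum_finite)

section \<open>Exponential majorants and convergence\<close>

lemma summable_on_exp_terms: "(\<lambda>n. x ^ n / fact n :: real) summable_on UNIV"
  by (rule norm_summable_imp_summable_on)
     (use summable_norm_exp[of x] in \<open>simp add: divide_inverse mult_ac\<close>)

text \<open>The majorant is a product of three exponential series; since its terms are nonnegative,
  iterated summability already gives joint summability.\<close>

lemma summable_on_exp_terms_triple:
  fixes A B C :: real
  assumes "A \<ge> 0" "B \<ge> 0" "C \<ge> 0"
  shows "(\<lambda>(j, m, n). A ^ j / fact j * (B ^ m / fact m * (C ^ n / fact n))) summable_on UNIV"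
proof -
  have prod: "(\<lambda>(x, y). f x * g y) summable_on UNIV"
    if "f summable_on UNIV" "g summable_on UNIV" "\<And>x. f x \<ge> 0" "\<And>y. g y \<ge> 0"
    for f :: "nat \<Rightarrow> real" and g :: "'b \<Rightarrow> real"
  proof -
    have "(\<lambda>(x, y). f x * g y) summable_on (SIGMA x:UNIV. UNIV)"
    proof (rule summable_on_SigmaI)
      show "((\<lambda>y. (\<lambda>(x, y). f x * g y) (x, y)) has_sum (f x * infsum g UNIV)) UNIV" for x
        using that(2) by (simp add: has_sum_cmult_right)
      show "(\<lambda>x. f x * infsum g UNIV) summable_on UNIV"
        using that(1) by (rule summable_on_cmult_left)
    qed (use that in auto)
    then show ?thesis by simp
  qed
  have "(\<lambda>(m, n). B ^ m / fact m * (C ^ n / fact n)) summable_on UNIV"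
    using assms by (intro prod summable_on_exp_terms) auto
  then have "(\<lambda>(j, y). A ^ j / fact j * (\<lambda>(m, n). B ^ m / fact m * (C ^ n / fact n)) y) summable_on UNIV"
    using assms by (intro prod summable_on_exp_terms) auto
  then show ?thesis by (simp add: case_prod_unfold)
qed

text \<open>The quotient of the two sides is a binomial coefficient, hence a positive
  integer.\<close>

lemma fact_mult_le_fact_add: "fact k * fact n \<le> (fact (k + n) :: real)"
proof -
  have "fact k * fact n \<le> (fact (k + n) :: nat)"
    by (intro dvd_imp_le fact_fact_dvd_fact) simp
  then have "real (fact k * fact n) \<le> real (fact (k + n))"
    by (rule of_nat_mono)
  then show ?thesis by simp
qed

lemma summable_hypergeom_1_1:
  fixes u v z :: complex
  assumes "Re v > 0"
  shows "summable (\<lambda>n. pochhammer u n / pochhammer v n * (z ^ n / fact n))"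
proof -
  obtain K where K: "K \<ge> 0" "\<And>n. norm (pochhammer u n) \<le> K ^ n * fact n"
    using norm_pochhammer_le_fact by blast
  obtain L where L: "L \<ge> 0" "\<And>n. norm (inverse (pochhammer v n)) \<le> L ^ n / fact n"
    using norm_inverse_pochhammer_le_fact[OF assms] by blast
  show ?thesis
  proof (rule summable_comparison_test)
    show "summable (\<lambda>n. (K * L * norm z) ^ n / fact n)"
      by (intro summable_on_imp_summable summable_on_exp_terms)
    have "norm (pochhammer u n) * norm (inverse (pochhammer v n)) * (norm z ^ n / fact n)
        \<le> (K ^ n * fact n) * (L ^ n / fact n) * (norm z ^ n / fact n)" for n
      using K L by (intro mult_mono) auto
    then have "norm (pochhammer u n / pochhammer v n * (z ^ n / fact n))
        \<le> (K * L * norm z) ^ n / fact n" for n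
      by (simp add: norm_mult norm_divide norm_power norm_inverse power_mult_distrib field_simps)
    then show "\<exists>N. \<forall>n\<ge>N. norm (pochhammer u n / pochhammer v n * (z ^ n / fact n))
        \<le> (K * L * norm z) ^ n / fact n"
      by blast
  qed
qed

text \<open>The factor \<open>pochhammer (- of_nat k) j\<close> vanishes for \<open>j > k\<close>,
  which cuts the series off.\<close>

lemma hypergeom_terminating:
  "hypergeom (- of_nat k # as) bs z =
     (\<Sum>j\<le>k. pochhammer (- of_nat k) j * (\<Prod>a\<leftarrow>as. pochhammer a j) / (\<Prod>b\<leftarrow>bs. pochhammer b j)
        * (z ^ j / fact j))"
  unfolding hypergeom_def by (subst suminf_finite[of "{..k}"]) (auto simp: pochhammer_of_nat_eq_0_iff)

section \<open>The triple series and its two orders of summation\<close>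

context
  fixes p q s t w \<rho> :: complex
  assumes s: "Re s > 0" and t: "Re t > 0" and w: "Re w > 0"
begin

text \<open>In the application \<open>p\<close> and \<open>q\<close> are \<open>a + \<i> * x\<close>
  and \<open>a - \<i> * x\<close>, while \<open>s = a + b\<close>, \<open>t = a + d\<close> and
  \<open>w = a + c\<close>, so that \<open>w - t = c - d\<close>. With \<open>k = j + m\<close>, the
  sign and \<open>fact m\<close> come from
  \<open>pochhammer (- of_nat k) j / fact k = (- 1) ^ j / fact m\<close>.\<close>

definition triple :: "nat \<times> nat \<times> nat \<Rightarrow> complex" where
  "triple = (\<lambda>(j, m, n).
     (- 1) ^ j * (pochhammer p j * pochhammer q j / (pochhammer s j * pochhammer t j * fact j))
     * (pochhammer t (j + m) * pochhammer (w - t) n / (pochhammer w (j + m + n) * fact m * fact n))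
     * \<rho> ^ (j + m + n))"

lemma triple_summable: "triple summable_on UNIV"
proof -
  obtain Kp where Kp: "Kp \<ge> 0" "\<And>n. norm (pochhammer p n) \<le> Kp ^ n * fact n"
    using norm_pochhammer_le_fact by blast
  obtain Kq where Kq: "Kq \<ge> 0" "\<And>n. norm (pochhammer q n) \<le> Kq ^ n * fact n"
    using norm_pochhammer_le_fact by blast
  obtain Kt where Kt: "Kt \<ge> 0" "\<And>n. norm (pochhammer t n) \<le> Kt ^ n * fact n"
    using norm_pochhammer_le_fact by blast
  obtain Kv where Kv: "Kv \<ge> 0" "\<And>n. norm (pochhammer (w - t) n) \<le> Kv ^ n * fact n"
    using norm_pochhammer_le_fact by blast
  obtain Ls where Ls: "Ls \<ge> 0" "\<And>n. norm (inverse (pochhammer s n)) \<le> Ls ^ n / fact n"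
    using norm_inverse_pochhammer_le_fact[OF s] by blast
  obtain Lt where Lt: "Lt \<ge> 0" "\<And>n. norm (inverse (pochhammer t n)) \<le> Lt ^ n / fact n"
    using norm_inverse_pochhammer_le_fact[OF t] by blast
  obtain Lw where Lw: "Lw \<ge> 0" "\<And>n. norm (inverse (pochhammer w n)) \<le> Lw ^ n / fact n"
    using norm_inverse_pochhammer_le_fact[OF w] by blast
  \<comment> \<open>The bound for \<open>pochhammer t (j + m)\<close> feeds \<open>A\<close> and
    \<open>B\<close>; the bound for the inverse of \<open>pochhammer w (j + m + n)\<close> and the
    power of \<open>\<rho>\<close> feed all three constants.\<close>
  define A where "A = Kp * Kq * Ls * Lt * Kt * Lw * norm \<rho>"
  define B where "B = Kt * Lw * norm \<rho>"
  define C where "C = Kv * Lw * norm \<rho>"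
  have ABC: "A \<ge> 0" "B \<ge> 0" "C \<ge> 0"
    using Kp Kq Kt Kv Ls Lt Lw by (simp_all add: A_def B_def C_def)
  have bound: "norm (triple (j, m, n)) \<le> A ^ j / fact j * (B ^ m / fact m * (C ^ n / fact n))"
    for j m n
  proof -
    have "norm (triple (j, m, n)) =
        norm (pochhammer p j) * norm (pochhammer q j) * norm (inverse (pochhammer s j))
        * norm (inverse (pochhammer t j)) * norm (pochhammer t (j + m))
        * norm (pochhammer (w - t) n) * norm (inverse (pochhammer w (j + m + n)))
        * (norm \<rho> ^ (j + m + n) / (fact j * fact m * fact n))"
      by (simp add: triple_def norm_mult norm_divide norm_power norm_inverse divide_inverse mult_ac)
    also have "\<dots> \<le> (Kp ^ j * fact j) * (Kq ^ j * fact j) * (Ls ^ j / fact j) * (Lt ^ j / fact j)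
        * (Kt ^ (j + m) * fact (j + m)) * (Kv ^ n * fact n) * (Lw ^ (j + m + n) / fact (j + m + n))
        * (norm \<rho> ^ (j + m + n) / (fact j * fact m * fact n))"
      using Kp(1) Kq(1) Kt(1) Kv(1) Ls(1) Lt(1) Lw(1)
      by (intro mult_mono Kp(2) Kq(2) Kt(2) Kv(2) Ls(2) Lt(2) Lw(2) order_refl) simp_all
    also have "\<dots> = A ^ j / fact j * (B ^ m / fact m * (C ^ n / fact n))
        * (fact (j + m) * fact n / fact (j + m + n))"
      by (simp add: A_def B_def C_def power_mult_distrib power_add mult_ac)
    also have "\<dots> \<le> A ^ j / fact j * (B ^ m / fact m * (C ^ n / fact n)) * 1"
      using ABC fact_mult_le_fact_add[of "j + m" n] by (intro mult_left_mono) simp_all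
    finally show ?thesis by simp
  qed
  show ?thesis
    using Infinite_Sum.abs_summable_on_comparison_test'[OF summable_on_exp_terms_triple[OF ABC], of triple] bound
    by (auto intro: abs_summable_summable)
qed

text \<open>Splitting \<open>pochhammer w (j + m + n)\<close> at \<open>j + m\<close> shifts its
  base to \<open>w + j + m\<close> and isolates the dependence on \<open>n\<close> as a
  \<open>1F1\<close> series.\<close>

lemma triple_sum_last:
  "((\<lambda>n. triple (j, m, n)) has_sum
      (- 1) ^ j * (pochhammer p j * pochhammer q j / (pochhammer s j * pochhammer t j * fact j))
      * (pochhammer t (j + m) / (pochhammer w (j + m) * fact m)) * \<rho> ^ (j + m)
      * hypergeom [w - t] [of_nat (j + m) + w] \<rho>) UNIV"
    (is "(_ has_sum ?c * _) _")
proof -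
  have "(\<lambda>n. triple (j, m, n)) summable_on UNIV"
    using summable_on_SigmaD1[of "\<lambda>j y. triple (j, y)" UNIV "\<lambda>_. UNIV" j] triple_summable
      summable_on_SigmaD1[of "\<lambda>m n. triple (j, m, n)" UNIV "\<lambda>_. UNIV" m]
    by (simp add: case_prod_unfold)
  then obtain S where S: "((\<lambda>n. triple (j, m, n)) has_sum S) UNIV"
    by (auto simp: summable_on_def)
  have Re: "Re (of_nat (j + m) + w) > 0"
    using w by simp
  have "triple (j, m, n) = ?c * (pochhammer (w - t) n / pochhammer (of_nat (j + m) + w) n
      * (\<rho> ^ n / fact n))" for n
    by (simp add: triple_def pochhammer_product'[of w "j + m" n] power_add add.commute[of w] mult_ac)
  moreover have "(\<lambda>n. ?c * (pochhammer (w - t) n / pochhammer (of_nat (j + m) + w) n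
      * (\<rho> ^ n / fact n))) sums (?c * hypergeom [w - t] [of_nat (j + m) + w] \<rho>)"
    using summable_sums[OF summable_hypergeom_1_1[OF Re, of "w - t" \<rho>]]
    unfolding hypergeom_def by (intro sums_mult) simp
  ultimately have "S = ?c * hypergeom [w - t] [of_nat (j + m) + w] \<rho>"
    using sums_unique2[OF has_sum_imp_sums[OF S]] by presburger
  with S show ?thesis by blast
qed

text \<open>Splitting off the first \<open>j\<close> factors of the symbols in \<open>t\<close> and
  \<open>w\<close> leaves a Chu--Vandermonde sum with parameters \<open>t + j\<close> and
  \<open>w - t\<close>. Its value \<open>pochhammer (w + of_nat j) N\<close> cancels the
  denominator.\<close>

lemma triple_antidiagonal_last:
  "(\<Sum>m\<le>N. triple (j, m, N - m)) =
     pochhammer p j * pochhammer q j / (pochhammer s j * pochhammer w j) * ((- \<rho>) ^ j / fact j)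
     * (\<rho> ^ N / fact N)"
    (is "_ = ?c * _")
proof -
  have "triple (j, m, N - m) = ?c * (\<rho> ^ N / (pochhammer (w + of_nat j) N * fact N))
      * (of_nat (N choose m) * pochhammer (t + of_nat j) m * pochhammer (w - t) (N - m))"
    if "m \<le> N" for m
  proof -
    have eq: "j + m + (N - m) = j + N" using that by simp
    have "triple (j, m, N - m) = (- 1) ^ j * (pochhammer p j * pochhammer q j / (pochhammer s j * pochhammer t j * fact j))
     * (pochhammer t j * pochhammer (t + of_nat j) m * pochhammer (w - t) (N - m)
        / (pochhammer w j * pochhammer (w + of_nat j) N * fact m * fact (N - m)))
     * (\<rho> ^ j * \<rho> ^ N)"
      by (simp only: triple_def prod.case eq pochhammer_product'[of t j m]
          pochhammer_product'[of w j N] power_add[of \<rho> j N])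
    then show ?thesis
      using that pochhammer_Re_pos_nonzero[OF t]
      by (simp add: binomial_fact power_minus[of \<rho>] mult_ac)
  qed
  then have "(\<Sum>m\<le>N. triple (j, m, N - m)) =
      ?c * (\<rho> ^ N / (pochhammer (w + of_nat j) N * fact N))
      * (\<Sum>m\<le>N. of_nat (N choose m) * pochhammer (t + of_nat j) m * pochhammer (w - t) (N - m))"
    by (simp add: sum_distrib_left)
  also have "(\<Sum>m\<le>N. of_nat (N choose m) * pochhammer (t + of_nat j) m * pochhammer (w - t) (N - m))
      = pochhammer (w + of_nat j) N"
    using pochhammer_binomial_sum[of "t + of_nat j" "w - t" N] by (simp add: algebra_simps)
  finally show ?thesis
    using pochhammer_Re_pos_nonzero[of "w + of_nat j" N] w by (simp add: mult_ac)
qed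

text \<open>First order of summation: \<open>j\<close> is held fixed while \<open>(m, n)\<close> is
  summed by antidiagonals, and \<open>j\<close> is summed last.\<close>

lemma has_sum_triple:
  "(triple has_sum exp \<rho> * hypergeom [p, q] [s, w] (- \<rho>)) UNIV"
proof -
  let ?g = "\<lambda>j. pochhammer p j * pochhammer q j / (pochhammer s j * pochhammer w j) * ((- \<rho>) ^ j / fact j)"
  obtain S where S: "(triple has_sum S) UNIV"
    using triple_summable by (auto simp: summable_on_def)
  have "((\<lambda>y. triple (j, y)) has_sum exp \<rho> * ?g j) UNIV" for j
  proof -
    have "(\<lambda>y. triple (j, y)) summable_on UNIV"
      using summable_on_SigmaD1[of "\<lambda>j y. triple (j, y)" UNIV "\<lambda>_. UNIV" j] triple_summable
      by (simp add: case_prod_unfold)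
    then obtain T where T: "((\<lambda>y. triple (j, y)) has_sum T) UNIV"
      by (auto simp: summable_on_def)
    have "(\<lambda>N. ?g j * (\<rho> ^ N / fact N)) sums T"
      using has_sum_imp_sums[OF has_sum_antidiagonals[OF T]]
      by (simp add: triple_antidiagonal_last)
    moreover have "(\<lambda>N. ?g j * (\<rho> ^ N / fact N)) sums (?g j * exp \<rho>)"
      using exp_converges[of \<rho>] by (intro sums_mult) (simp add: scaleR_conv_of_real divide_inverse mult_ac)
    ultimately have "T = ?g j * exp \<rho>"
      by (rule sums_unique2)
    with T show ?thesis by (simp only: mult.commute[of "exp \<rho>"])
  qed
  with S have "((\<lambda>j. exp \<rho> * ?g j) has_sum S) UNIV"
    by (intro has_sum_SigmaD[where f = triple and A = UNIV and B = "\<lambda>_. UNIV"]) (simp_all only: UNIV_Times_UNIV)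
  \<comment> \<open>Dividing by the nonzero \<open>exp \<rho>\<close> makes convergence of the
    \<open>2F2\<close> series a consequence of the summability of \<open>triple\<close>.\<close>
  then have "(?g has_sum S / exp \<rho>) UNIV"
    by (subst (asm) has_sum_cmult_right_iff) simp_all
  then have "hypergeom [p, q] [s, w] (- \<rho>) = S / exp \<rho>"
    unfolding hypergeom_def using sums_unique[OF has_sum_imp_sums] by fastforce
  with S show ?thesis by simp
qed

text \<open>Second order of summation: \<open>n\<close> first, giving \<open>1F1\<close>, then
  \<open>(j, m)\<close> along \<open>j + m = k\<close>, giving the terminating
  \<open>3F2\<close>.\<close>

lemma sums_hypergeom_3_2:
  "(\<lambda>k. \<rho> ^ k * pochhammer t k / (pochhammer w k * fact k)
        * hypergeom [- of_nat k, p, q] [s, t] 1 * hypergeom [w - t] [of_nat k + w] \<rho>)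
   sums (exp \<rho> * hypergeom [p, q] [s, w] (- \<rho>))"
proof -
  let ?G = "\<lambda>(j, m). (- 1) ^ j * (pochhammer p j * pochhammer q j / (pochhammer s j * pochhammer t j * fact j))
      * (pochhammer t (j + m) / (pochhammer w (j + m) * fact m)) * \<rho> ^ (j + m)
      * hypergeom [w - t] [of_nat (j + m) + w] \<rho>"
  have "((\<lambda>((j, m), n). triple (j, m, n)) has_sum exp \<rho> * hypergeom [p, q] [s, w] (- \<rho>)) UNIV"
  proof -
    have "bij_betw (\<lambda>((j, m), n). (j, m, n)) UNIV (UNIV :: (nat \<times> nat \<times> nat) set)"
      by (rule bij_betwI[of _ _ _ "\<lambda>(j, m, n). ((j, m), n)"]) auto
    from has_sum_reindex_bij_betw[OF this, of triple] has_sum_triple show ?thesis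
      by (simp add: case_prod_unfold)
  qed
  then have "(?G has_sum exp \<rho> * hypergeom [p, q] [s, w] (- \<rho>)) UNIV"
    by (intro has_sum_SigmaD[where A = UNIV and B = "\<lambda>_. UNIV"
          and f = "\<lambda>((j, m), n). triple (j, m, n)"])
       (use triple_sum_last in auto)
  from has_sum_imp_sums[OF has_sum_antidiagonals[OF this]]
  have "(\<lambda>k. \<Sum>j\<le>k. ?G (j, k - j)) sums (exp \<rho> * hypergeom [p, q] [s, w] (- \<rho>))" .
  moreover have "(\<Sum>j\<le>k. ?G (j, k - j)) = \<rho> ^ k * pochhammer t k / (pochhammer w k * fact k)
        * hypergeom [- of_nat k, p, q] [s, t] 1 * hypergeom [w - t] [of_nat k + w] \<rho>" for k
    \<comment> \<open>Here \<open>m = k - j\<close>, and \<open>pochhammer_neg_of_nat\<close> turns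
      \<open>(- 1) ^ j / fact (k - j)\<close> back into
      \<open>pochhammer (- of_nat k) j / fact k\<close>.\<close>
    unfolding hypergeom_terminating sum_distrib_left sum_distrib_right
    by (intro sum.cong refl) (simp add: pochhammer_neg_of_nat mult_ac)
  ultimately show ?thesis by simp
qed

end

theorem theorem3p5:
  fixes a b c d \<rho> :: complex and x :: real
  assumes "x > 0"
    and "admissible_params [a, b, c]"
    and "admissible_params [a, b, d]"
  shows "(\<lambda>k. \<rho> ^ k * cont_dual_hahn k ((of_real x)\<^sup>2) a b d
              / (pochhammer (a + b) k * pochhammer (a + c) k * fact k)
            * hypergeom [c - d] [of_nat k + a + c] \<rho>)
         sums (exp \<rho> * hypergeom [a + \<i> * of_real x, a - \<i> * of_real x] [a + b, a + c] (- \<rho>))"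
proof -
  have "Re a > 0" "Re b > 0" "Re c > 0" "Re d > 0"
    using assms(2,3) by (auto simp: admissible_params_def)
  then have Re: "Re (a + b) > 0" "Re (a + d) > 0" "Re (a + c) > 0"
    by simp_all
  have "\<rho> ^ k * cont_dual_hahn k ((of_real x)\<^sup>2) a b d
          / (pochhammer (a + b) k * pochhammer (a + c) k * fact k)
        * hypergeom [c - d] [of_nat k + a + c] \<rho>
      = \<rho> ^ k * pochhammer (a + d) k / (pochhammer (a + c) k * fact k)
        * hypergeom [- of_nat k, a + \<i> * of_real x, a - \<i> * of_real x] [a + b, a + d] 1
        * hypergeom [(a + c) - (a + d)] [of_nat k + (a + c)] \<rho>" for k
    \<comment> \<open>Of the prefactor of the polynomial, \<open>pochhammer (a + b) k\<close>
      cancels against the denominator and \<open>pochhammer (a + d) k\<close> stays as the symbol in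
      \<open>t\<close>.\<close>
    unfolding cont_dual_hahn_square
    using pochhammer_Re_pos_nonzero[OF Re(1), of k] by (simp add: add.assoc)
  then show ?thesis
    using sums_hypergeom_3_2[OF Re, of \<rho> "a + \<i> * of_real x" "a - \<i> * of_real x"] by simp
qed

end
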